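(* There is no infinite monochromatic arithmetic progression in the Rudin--Shapiro sequence $u\in\{1,-1\}^{\mathbb{N}}$; that is, there are no $s\in\mathbb{N}$ and $d\geqslant 1$ such that $u_{s+nd}=u_s$ for all $n\in\mathbb{N}$.
   Context: $\mathbb{N}=\mathbb{Z}_{\geqslant0}$. The Rudin--Shapiro sequence $u=u_0u_1u_2\cdots$ over $\{1,-1\}$ is the image of the fixed point, starting with $0$, of the substitution $\theta\colon 0\mapsto 01,\ 1\mapsto 0\tilde{1},\ \tilde{0}\mapsto\tilde{0}\tilde{1},\ \tilde{1}\mapsto\tilde{0}1$ on the alphabet $\{0,1,\tilde0,\tilde1\}$ under the letterwise map $0,1\mapsto 1$, $\tilde{0},\tilde{1}\mapsto -1$. Equivalently, $u_n=(-1)^{t(n)}$ where $t(n)$ is the number of (possibly overlapping) occurrences of the block $11$ in the binary representation of $n$. *)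

theory Defs
  imports Main "HOL-Library.Stream"
begin

text \<open>\<open>Zero'\<close> and \<open>One'\<close> stand for the letters 0 and 1 with a tilde.\<close>

datatype letter = Zero | One | Zero' | One'

fun theta :: "letter \<Rightarrow> letter list" where
  "theta Zero = [Zero, One]"
| "theta One = [Zero, One']"
| "theta Zero' = [Zero', One']"
| "theta One' = [Zero', One]"

definition theta_ext :: "letter stream \<Rightarrow> letter stream" where
  "theta_ext w = flat (smap theta w)"

definition rs_fixed_point :: "letter stream" where
  "rs_fixed_point = (THE w. shd w = Zero \<and> theta_ext w = w)"

fun letter_sign :: "letter \<Rightarrow> int" where
  "letter_sign Zero = 1"
| "letter_sign One = 1"
| "letter_sign Zero' = -1"
| "letter_sign One' = -1"

definition rudin_shapiro :: "int stream" where
  "rudin_shapiro = smap letter_sign rs_fixed_point"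

text \<open>The definite description is justified: the fixed point exists and is unique.\<close>

lemma theta_eq: "theta a = [theta a ! 0, theta a ! 1]"
  by (cases a) simp_all

lemma theta_ext_unfold:
  "theta_ext w = theta (shd w) ! 0 ## theta (shd w) ! 1 ## theta_ext (stl w)"
proof -
  have "flat (smap theta w) = theta (shd w) @- flat (smap theta (stl w))"
    by (metis flat_unfold stream.map_sel list.distinct(1) theta_eq)
  then show ?thesis
    unfolding theta_ext_def by (subst (asm) theta_eq) simp
qed

lemma snth_theta_ext: "theta_ext w !! n = theta (w !! (n div 2)) ! (n mod 2)"
proof (induction n arbitrary: w rule: less_induct)
  case (less n)
  consider "n = 0" | "n = 1" | m where "n = Suc (Suc m)"
    by (metis One_nat_def not0_implies_Suc)
  then show ?case
  proof cases
    case 3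
    then show ?thesis
      using less[of m "stl w"] by (subst theta_ext_unfold) simp
  qed (subst theta_ext_unfold, simp)+
qed

fun rs_letter :: "nat \<Rightarrow> letter" where
  "rs_letter n = (if n = 0 then Zero else theta (rs_letter (n div 2)) ! (n mod 2))"

declare rs_letter.simps [simp del]

lemma rs_letter_step: "rs_letter n = theta (rs_letter (n div 2)) ! (n mod 2)"
  by (cases "n = 0") (simp_all add: rs_letter.simps)

lemma stream_eqI: "(\<And>n. s !! n = t !! n) \<Longrightarrow> s = t"
  by (metis ext stream_smap_nats)

lemma fixed_point_iff:
  "shd w = Zero \<and> theta_ext w = w \<longleftrightarrow> w = smap rs_letter nats"
proof
  assume *: "shd w = Zero \<and> theta_ext w = w"
  have "w !! n = rs_letter n" for n
  proof (induction n rule: less_induct)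
    case (less n)
    show ?case
    proof (cases "n = 0")
      case True
      then show ?thesis using * by (simp add: rs_letter.simps)
    next
      case False
      then have "w !! (n div 2) = rs_letter (n div 2)"
        using less by simp
      then show ?thesis
        using * snth_theta_ext[of w n] rs_letter_step[of n] by simp
    qed
  qed
  then show "w = smap rs_letter nats"
    by (intro stream_eqI) simp
next
  assume w: "w = smap rs_letter nats"
  have "theta_ext w !! n = w !! n" for n
    using rs_letter_step[of n] by (simp add: snth_theta_ext w)
  then have "theta_ext w = w"
    by (rule stream_eqI)
  moreover have "shd w = Zero"
    by (simp add: w rs_letter.simps)
  ultimately show "shd w = Zero \<and> theta_ext w = w"
    by simp
qed

lemma ex1_fixed_point: "\<exists>!w. shd w = Zero \<and> theta_ext w = w"
  by (simp only: fixed_point_iff) blast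

lemma shd_rs_fixed_point: "shd rs_fixed_point = Zero"
  and theta_ext_rs_fixed_point: "theta_ext rs_fixed_point = rs_fixed_point"
  using theI'[OF ex1_fixed_point] unfolding rs_fixed_point_def by simp_all

end

(*
  If u is constant on s + dN, choose K with s < 2^K. The numbers s + 2^(K+1) d j lie in the
  progression, and their binary expansions are those of dj and s separated by a zero digit, so
  u(s + 2^(K+1) d j) = u(s) u(dj). Hence u(dj) = 1 for all j. But d divides some 2^e (2^k - 1)
  with k even and positive, whose k leading ones contribute k - 1 blocks 11, so that u takes
  the value -1 there.
*)
theory Submission
  imports Defs "HOL-Number_Theory.Residues"
begin

definition rs_sign :: "nat \<Rightarrow> int" where
  "rs_sign n = letter_sign (rs_letter n)"

lemma rudin_shapiro_snth: "rudin_shapiro !! n = rs_sign n"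
proof -
  have fp: "rs_fixed_point = smap rs_letter nats"
    using fixed_point_iff shd_rs_fixed_point theta_ext_rs_fixed_point by blast
  show ?thesis
    by (simp add: rudin_shapiro_def rs_sign_def fp)
qed

text \<open>Each image under \<open>theta\<close> starts with \<open>Zero\<close> or
  \<open>Zero'\<close> and ends with \<open>One\<close> or \<open>One'\<close>, so the letter
  remembers the last binary digit.\<close>

lemma rs_letter_odd_iff: "rs_letter n \<in> {One, One'} \<longleftrightarrow> odd n"
  by (subst rs_letter_step, cases "rs_letter (n div 2)"; cases "even n")
     (auto simp: even_iff_mod_2_eq_zero odd_iff_mod_2_eq_one)

lemma rs_sign_0 [simp]: "rs_sign 0 = 1"
  by (simp add: rs_sign_def rs_letter.simps)

lemma rs_sign_double: "rs_sign (2 * n) = rs_sign n"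
  unfolding rs_sign_def
  by (subst rs_letter_step) (cases "rs_letter n", simp_all)

text \<open>Appending the digit 1 creates a new block 11 exactly when the previous last digit is
  1.\<close>

lemma rs_sign_double_Suc: "rs_sign (2 * n + 1) = (if odd n then - rs_sign n else rs_sign n)"
  using rs_letter_odd_iff[of n] unfolding rs_sign_def
  by (subst rs_letter_step) (cases "rs_letter n", simp_all)

lemma rs_sign_nonzero: "rs_sign n \<noteq> 0"
  unfolding rs_sign_def by (cases "rs_letter n") simp_all

lemma rs_sign_power2_mult: "rs_sign (2 ^ e * n) = rs_sign n"
  by (induction e) (simp_all add: mult.assoc rs_sign_double)

text \<open>Since \<open>m < 2 ^ k\<close>, digit \<open>k\<close> of the sum is 0, so no block 11
  straddles \<open>m\<close> and \<open>x\<close>. The induction strips the lowest digit of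
  \<open>m\<close>.\<close>

lemma rs_sign_add_power2_mult:
  "m < 2 ^ k \<Longrightarrow> rs_sign (m + 2 ^ Suc k * x) = rs_sign m * rs_sign x"
proof (induction k arbitrary: m)
  case 0
  then show ?case by (simp add: rs_sign_double)
next
  case (Suc k)
  define q where "q = m div 2"
  define y where "y = q + 2 ^ Suc k * x"
  have IH: "rs_sign y = rs_sign q * rs_sign x"
    unfolding y_def using Suc by (simp add: q_def)
  \<comment> \<open>The separating zero enters here: \<open>2 ^ Suc k * x\<close> is even also for
    \<open>k = 0\<close>.\<close>
  have parity: "odd y \<longleftrightarrow> odd q"
    by (simp add: y_def)
  show ?case
  proof (cases "even m")
    case True
    then have "m = 2 * q" "m + 2 ^ Suc (Suc k) * x = 2 * y"
      by (auto simp: q_def y_def)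
    then show ?thesis
      using IH by (simp only: rs_sign_double)
  next
    case False
    then have "m = 2 * q + 1" "m + 2 ^ Suc (Suc k) * x = 2 * y + 1"
      by (auto simp: q_def y_def elim!: oddE)
    then show ?thesis
      using IH parity by (simp only: rs_sign_double_Suc) simp
  qed
qed

text \<open>The number consists of \<open>k + 1\<close> binary ones, which contain \<open>k\<close>
  overlapping blocks 11.\<close>

lemma rs_sign_power2_minus_1: "rs_sign (2 ^ Suc k - 1) = (-1) ^ k"
proof (induction k)
  case 0
  show ?case using rs_sign_double_Suc[of 0] by simp
next
  case (Suc k)
  have "(2::nat) ^ Suc (Suc k) - 1 = 2 * (2 ^ Suc k - 1) + 1"
    using one_le_power[of "2::nat" k] unfolding power_Suc by linarith
  moreover have "odd ((2::nat) ^ Suc k - 1)"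
    by simp
  ultimately show ?case
    using Suc by (simp only: rs_sign_double_Suc) simp
qed

lemma ex_multiple_rs_sign_minus_1:
  assumes "d > 0"
  shows "\<exists>j. rs_sign (d * j) = -1"
proof -
  \<comment> \<open>The factor \<open>2 ^ e\<close> only appends zeros, and Euler's theorem applies
    to the odd part \<open>c\<close>.\<close>
  obtain e c where d: "d = 2 ^ e * c" and "odd c"
    using multiplicity_decompose'[of d 2] assms by (metis neq0_conv odd_one)
  define t where "t = totient c"
  have "c > 0"
    using \<open>odd c\<close> by (rule odd_pos)
  then have "t > 0"
    by (simp add: t_def)
  have "[2 ^ t = 1] (mod c)"
    unfolding t_def using \<open>odd c\<close> by (intro euler_theorem) simp
  \<comment> \<open>Squaring makes the exponent even, so that the number \<open>2 * t - 1\<close> of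
    blocks is odd.\<close>
  then have "[(2 ^ t) ^ 2 = 1 ^ 2] (mod c)"
    by (rule cong_pow)
  then have "[2 ^ (2 * t) = 1] (mod c)"
    by (simp add: power_mult[symmetric] mult.commute)
  then have "c dvd 2 ^ (2 * t) - 1"
    by (metis cong_altdef_nat' cong_to_1_nat)
  then obtain j where j: "2 ^ (2 * t) - 1 = c * j"
    by blast
  have "rs_sign (d * j) = rs_sign (2 ^ Suc (2 * t - 1) - 1)"
    using \<open>t > 0\<close> by (simp add: d mult.assoc j[symmetric] rs_sign_power2_mult)
  also have "\<dots> = -1"
    using \<open>t > 0\<close> by (simp only: rs_sign_power2_minus_1) simp
  finally show ?thesis ..
qed

theorem proposition41:
  "\<not> (\<exists>(s::nat) (d::nat). d \<ge> 1 \<and>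
       (\<forall>n::nat. rudin_shapiro !! (s + n * d) = rudin_shapiro !! s))"
proof
  assume "\<exists>(s::nat) (d::nat). d \<ge> 1 \<and>
       (\<forall>n::nat. rudin_shapiro !! (s + n * d) = rudin_shapiro !! s)"
  then obtain d s :: nat where "d > 0" and const: "\<And>n. rs_sign (s + n * d) = rs_sign s"
    by (auto simp: rudin_shapiro_snth Suc_le_eq)
  obtain j where j: "rs_sign (d * j) = -1"
    using ex_multiple_rs_sign_minus_1[OF \<open>d > 0\<close>] by blast
  \<comment> \<open>Taking \<open>k = s\<close> suffices because \<open>s < 2 ^ s\<close>.\<close>
  have "rs_sign (s + 2 ^ Suc s * (d * j)) = rs_sign s * rs_sign (d * j)"
    by (intro rs_sign_add_power2_mult) simp
  moreover have "rs_sign (s + 2 ^ Suc s * (d * j)) = rs_sign s"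
    using const[of "2 ^ Suc s * j"] by (simp add: mult_ac)
  ultimately show False
    using j rs_sign_nonzero[of s] by simp
qed

end
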